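(* If $\mathcal{C}$ is a left quasi-abelian category, then any strongly right exact structure on $\mathcal{C}$ is exact.
   Context: A right exact category is an additive category $\mathcal{C}$ endowed with a distinguished class of kernels (morphisms that are kernels of some morphism), called inflations, such that: [R0] the identity morphism $1_0:0\to 0$ is an inflation; [R1] the composition of any two inflations is an inflation; [R2] the pushout of any inflation along an arbitrary morphism exists and is again an inflation. By [R2] (pushout along $A\to 0$), every inflation $i:A\to B$ has a cokernel $d:B\to C$; such a $d$ is called a deflation, and $A\xrightarrow{i}B\xrightarrow{d}C$ (which is a kernel-cokernel pair) is called a conflation. It is strongly right exact if moreover: [R3] if $i:A\to B$ and $p:B\to C$ are morphisms such that $i$ has a cokernel and $pi$ is an inflation, then $i$ is an inflation. A (strongly) right exact structure on $\mathcal{C}$ is a choice of a class of inflations satisfying these axioms. A left exact category is one whose opposite is right exact: it has a distinguished class of cokernels, called deflations, such that: [R0$^{\rm op}$] the identity morphism $1_0:0\to 0$ is a deflation; [R1$^{\rm op}$] the composition of any two deflations is a deflation; [R2$^{\rm op}$] the pullback of any deflation along an arbitrary morphism exists and is again a deflation. The structure is exact if it is both right and left exact (for the same class of conflations), i.e. it is an exact structure in the sense of Quillen. An additive category is pre-abelian if every morphism has a kernel and a cokernel. It is left quasi-abelian if it is pre-abelian and cokernels are stable under pullbacks, i.e. the pullback of a cokernel along an arbitrary morphism is a cokernel. *)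

theory Defs
  imports "HOL-Algebra.Group"
begin

section \<open>Additive categories\<close>

text \<open>
  The addition of parallel morphisms and the zero morphisms are part of the data. On a category
  satisfying \<open>additive_category\<close> they are determined by the underlying category. The values of
  \<open>Dom\<close>, \<open>Cod\<close>, \<open>Comp\<close>, \<open>Plus\<close> outside their intended domains are irrelevant.
\<close>

record ('o, 'm) additive_data =
  Ob :: "'o set"
  Arr :: "'m set"
  Dom :: "'m \<Rightarrow> 'o"
  Cod :: "'m \<Rightarrow> 'o"
  Ident :: "'o \<Rightarrow> 'm"
  Comp :: "'m \<Rightarrow> 'm \<Rightarrow> 'm"  (infixl \<open>\<cdot>\<index>\<close> 70)
  Plus :: "'m \<Rightarrow> 'm \<Rightarrow> 'm"
  Zero :: "'o \<Rightarrow> 'o \<Rightarrow> 'm"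

definition Hom :: "('o, 'm) additive_data \<Rightarrow> 'o \<Rightarrow> 'o \<Rightarrow> 'm set" where
  "Hom C A B = {f \<in> Arr C. Dom C f = A \<and> Cod C f = B}"

definition zero_object :: "('o, 'm) additive_data \<Rightarrow> 'o \<Rightarrow> bool" where
  "zero_object C Z \<longleftrightarrow> Z \<in> Ob C \<and>
    (\<forall>A \<in> Ob C. (\<exists>!f. f \<in> Hom C Z A) \<and> (\<exists>!f. f \<in> Hom C A Z))"

locale additive_category =
  fixes C :: "('o, 'm) additive_data"
  assumes Dom_in_Ob: "f \<in> Arr C \<Longrightarrow> Dom C f \<in> Ob C"
    and Cod_in_Ob: "f \<in> Arr C \<Longrightarrow> Cod C f \<in> Ob C"
    and Ident_in_Hom: "A \<in> Ob C \<Longrightarrow> Ident C A \<in> Hom C A A"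
    and Comp_in_Hom: "\<lbrakk>f \<in> Hom C A B; g \<in> Hom C B D\<rbrakk> \<Longrightarrow> g \<cdot>\<^bsub>C\<^esub> f \<in> Hom C A D"
    and Comp_Ident: "f \<in> Hom C A B \<Longrightarrow> f \<cdot>\<^bsub>C\<^esub> Ident C A = f"
    and Ident_Comp: "f \<in> Hom C A B \<Longrightarrow> Ident C B \<cdot>\<^bsub>C\<^esub> f = f"
    and Comp_assoc: "\<lbrakk>f \<in> Hom C A B; g \<in> Hom C B D; h \<in> Hom C D E\<rbrakk>
      \<Longrightarrow> h \<cdot>\<^bsub>C\<^esub> (g \<cdot>\<^bsub>C\<^esub> f) = (h \<cdot>\<^bsub>C\<^esub> g) \<cdot>\<^bsub>C\<^esub> f"
    and Hom_comm_group: "\<lbrakk>A \<in> Ob C; B \<in> Ob C\<rbrakk>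
      \<Longrightarrow> comm_group \<lparr>carrier = Hom C A B, monoid.mult = Plus C, one = Zero C A B\<rparr>"
    and Comp_Plus: "\<lbrakk>f \<in> Hom C A B; f' \<in> Hom C A B; g \<in> Hom C B D\<rbrakk>
      \<Longrightarrow> g \<cdot>\<^bsub>C\<^esub> Plus C f f' = Plus C (g \<cdot>\<^bsub>C\<^esub> f) (g \<cdot>\<^bsub>C\<^esub> f')"
    and Plus_Comp: "\<lbrakk>f \<in> Hom C A B; g \<in> Hom C B D; g' \<in> Hom C B D\<rbrakk>
      \<Longrightarrow> Plus C g g' \<cdot>\<^bsub>C\<^esub> f = Plus C (g \<cdot>\<^bsub>C\<^esub> f) (g' \<cdot>\<^bsub>C\<^esub> f)"
    and zero_object_exists: "\<exists>Z. zero_object C Z"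
    and biproduct_exists: "\<lbrakk>A \<in> Ob C; B \<in> Ob C\<rbrakk>
      \<Longrightarrow> \<exists>P \<in> Ob C. \<exists>i1 \<in> Hom C A P. \<exists>i2 \<in> Hom C B P. \<exists>p1 \<in> Hom C P A. \<exists>p2 \<in> Hom C P B.
            p1 \<cdot>\<^bsub>C\<^esub> i1 = Ident C A \<and> p2 \<cdot>\<^bsub>C\<^esub> i2 = Ident C B \<and>
            p1 \<cdot>\<^bsub>C\<^esub> i2 = Zero C B A \<and> p2 \<cdot>\<^bsub>C\<^esub> i1 = Zero C A B \<and>
            Plus C (i1 \<cdot>\<^bsub>C\<^esub> p1) (i2 \<cdot>\<^bsub>C\<^esub> p2) = Ident C P"

section \<open>Kernels, cokernels, pushouts, pullbacks\<close>

text \<open>\<open>is_kernel C f k\<close>: the morphism \<open>k\<close> is a kernel of \<open>f\<close>.\<close>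

definition is_kernel :: "('o, 'm) additive_data \<Rightarrow> 'm \<Rightarrow> 'm \<Rightarrow> bool" where
  "is_kernel C f k \<longleftrightarrow> f \<in> Arr C \<and> k \<in> Arr C \<and> Cod C k = Dom C f \<and>
    f \<cdot>\<^bsub>C\<^esub> k = Zero C (Dom C k) (Cod C f) \<and>
    (\<forall>X \<in> Ob C. \<forall>g \<in> Hom C X (Dom C f). f \<cdot>\<^bsub>C\<^esub> g = Zero C X (Cod C f) \<longrightarrow>
       (\<exists>!u. u \<in> Hom C X (Dom C k) \<and> k \<cdot>\<^bsub>C\<^esub> u = g))"

definition is_cokernel :: "('o, 'm) additive_data \<Rightarrow> 'm \<Rightarrow> 'm \<Rightarrow> bool" where
  "is_cokernel C f d \<longleftrightarrow> f \<in> Arr C \<and> d \<in> Arr C \<and> Dom C d = Cod C f \<and>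
    d \<cdot>\<^bsub>C\<^esub> f = Zero C (Dom C f) (Cod C d) \<and>
    (\<forall>X \<in> Ob C. \<forall>g \<in> Hom C (Cod C f) X. g \<cdot>\<^bsub>C\<^esub> f = Zero C (Dom C f) X \<longrightarrow>
       (\<exists>!u. u \<in> Hom C (Cod C d) X \<and> u \<cdot>\<^bsub>C\<^esub> d = g))"

text \<open>
  \<open>is_pushout C f g f' g'\<close>: for \<open>f : A \<rightarrow> B\<close> and \<open>g : A \<rightarrow> A'\<close>, the square with
  \<open>f' : A' \<rightarrow> B'\<close> (opposite to \<open>f\<close>) and \<open>g' : B \<rightarrow> B'\<close> is a pushout; so \<open>f'\<close> is the pushout
  of \<open>f\<close> along \<open>g\<close>. Dually, \<open>is_pullback C f g f' g'\<close> says that \<open>f' : B' \<rightarrow> A'\<close> is the pullback of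
  \<open>f : B \<rightarrow> A\<close> along \<open>g : A' \<rightarrow> A\<close>.
\<close>

definition is_pushout :: "('o, 'm) additive_data \<Rightarrow> 'm \<Rightarrow> 'm \<Rightarrow> 'm \<Rightarrow> 'm \<Rightarrow> bool" where
  "is_pushout C f g f' g' \<longleftrightarrow>
    f \<in> Arr C \<and> g \<in> Arr C \<and> f' \<in> Arr C \<and> g' \<in> Arr C \<and>
    Dom C f = Dom C g \<and> Dom C f' = Cod C g \<and> Dom C g' = Cod C f \<and> Cod C f' = Cod C g' \<and>
    g' \<cdot>\<^bsub>C\<^esub> f = f' \<cdot>\<^bsub>C\<^esub> g \<and>
    (\<forall>X \<in> Ob C. \<forall>a \<in> Hom C (Cod C f) X. \<forall>b \<in> Hom C (Cod C g) X. a \<cdot>\<^bsub>C\<^esub> f = b \<cdot>\<^bsub>C\<^esub> g \<longrightarrow>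
       (\<exists>!u. u \<in> Hom C (Cod C f') X \<and> u \<cdot>\<^bsub>C\<^esub> g' = a \<and> u \<cdot>\<^bsub>C\<^esub> f' = b))"

definition is_pullback :: "('o, 'm) additive_data \<Rightarrow> 'm \<Rightarrow> 'm \<Rightarrow> 'm \<Rightarrow> 'm \<Rightarrow> bool" where
  "is_pullback C f g f' g' \<longleftrightarrow>
    f \<in> Arr C \<and> g \<in> Arr C \<and> f' \<in> Arr C \<and> g' \<in> Arr C \<and>
    Cod C f = Cod C g \<and> Cod C f' = Dom C g \<and> Cod C g' = Dom C f \<and> Dom C f' = Dom C g' \<and>
    f \<cdot>\<^bsub>C\<^esub> g' = g \<cdot>\<^bsub>C\<^esub> f' \<and>
    (\<forall>X \<in> Ob C. \<forall>a \<in> Hom C X (Dom C f). \<forall>b \<in> Hom C X (Dom C g). f \<cdot>\<^bsub>C\<^esub> a = g \<cdot>\<^bsub>C\<^esub> b \<longrightarrow>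
       (\<exists>!u. u \<in> Hom C X (Dom C f') \<and> g' \<cdot>\<^bsub>C\<^esub> u = a \<and> f' \<cdot>\<^bsub>C\<^esub> u = b))"

section \<open>Pre-abelian and left quasi-abelian categories\<close>

locale pre_abelian_category = additive_category C
  for C :: "('o, 'm) additive_data" +
  assumes kernel_exists: "f \<in> Arr C \<Longrightarrow> \<exists>k. is_kernel C f k"
    and cokernel_exists: "f \<in> Arr C \<Longrightarrow> \<exists>d. is_cokernel C f d"

locale left_quasi_abelian_category = pre_abelian_category C
  for C :: "('o, 'm) additive_data" +
  assumes cokernel_pullback: "\<lbrakk>\<exists>f. is_cokernel C f d; is_pullback C d g d' g'\<rbrakk>
    \<Longrightarrow> \<exists>f'. is_cokernel C f' d'"

section \<open>Right exact, left exact and exact structures\<close>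

text \<open>
  The axioms about pushouts (pullbacks) speak about every pushout (pullback) square, these being
  determined only up to isomorphism; likewise the axioms about \<open>0\<close> speak about every zero object.
\<close>

locale right_exact_structure = additive_category C
  for C :: "('o, 'm) additive_data" +
  fixes Infl :: "'m set"
  assumes inflation_is_kernel: "i \<in> Infl \<Longrightarrow> \<exists>f. is_kernel C f i"
    and R0: "zero_object C Z \<Longrightarrow> Ident C Z \<in> Infl"
    and R1: "\<lbrakk>i \<in> Infl; j \<in> Infl; Cod C i = Dom C j\<rbrakk> \<Longrightarrow> j \<cdot>\<^bsub>C\<^esub> i \<in> Infl"
    and R2_exists: "\<lbrakk>i \<in> Infl; f \<in> Arr C; Dom C f = Dom C i\<rbrakk> \<Longrightarrow> \<exists>i' f'. is_pushout C i f i' f'"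
    and R2_inflation: "\<lbrakk>i \<in> Infl; is_pushout C i f i' f'\<rbrakk> \<Longrightarrow> i' \<in> Infl"

locale strongly_right_exact_structure = right_exact_structure C Infl
  for C :: "('o, 'm) additive_data" and Infl :: "'m set" +
  assumes R3: "\<lbrakk>i \<in> Arr C; p \<in> Arr C; Cod C i = Dom C p; \<exists>d. is_cokernel C i d; p \<cdot>\<^bsub>C\<^esub> i \<in> Infl\<rbrakk>
    \<Longrightarrow> i \<in> Infl"

locale left_exact_structure = additive_category C
  for C :: "('o, 'm) additive_data" +
  fixes Defl :: "'m set"
  assumes deflation_is_cokernel: "d \<in> Defl \<Longrightarrow> \<exists>f. is_cokernel C f d"
    and R0_op: "zero_object C Z \<Longrightarrow> Ident C Z \<in> Defl"
    and R1_op: "\<lbrakk>d \<in> Defl; e \<in> Defl; Cod C d = Dom C e\<rbrakk> \<Longrightarrow> e \<cdot>\<^bsub>C\<^esub> d \<in> Defl"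
    and R2_op_exists: "\<lbrakk>d \<in> Defl; f \<in> Arr C; Cod C f = Cod C d\<rbrakk> \<Longrightarrow> \<exists>d' f'. is_pullback C d f d' f'"
    and R2_op_deflation: "\<lbrakk>d \<in> Defl; is_pullback C d f d' f'\<rbrakk> \<Longrightarrow> d' \<in> Defl"

text \<open>The conflations of a right (left) exact structure given by its inflations (deflations).\<close>

definition right_conflations :: "('o, 'm) additive_data \<Rightarrow> 'm set \<Rightarrow> ('m \<times> 'm) set" where
  "right_conflations C Infl = {(i, d). i \<in> Infl \<and> is_cokernel C i d}"

definition left_conflations :: "('o, 'm) additive_data \<Rightarrow> 'm set \<Rightarrow> ('m \<times> 'm) set" where
  "left_conflations C Defl = {(i, d). d \<in> Defl \<and> is_kernel C d i}"

text \<open>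
  A structure given by its inflations is exact if its conflations are also the conflations of
  a left exact structure; the latter is then unique, its deflations being the second components.
\<close>

definition exact_structure :: "('o, 'm) additive_data \<Rightarrow> 'm set \<Rightarrow> bool" where
  "exact_structure C Infl \<longleftrightarrow> right_exact_structure C Infl \<and>
    (\<exists>Defl. left_exact_structure C Defl \<and> left_conflations C Defl = right_conflations C Infl)"

end

theory Submission
  imports Defs
begin

text \<open>
  The deflations are the cokernels of inflations. For the pullback \<open>d'\<close> of a deflation \<open>d\<close>, with
  \<open>f'\<close> the opposite side and \<open>k\<close> a kernel of \<open>d'\<close>, the composite \<open>f' k\<close> is a kernel of \<open>d\<close>, so
  \<open>k\<close> is an inflation by [R3], and \<open>d'\<close> is a cokernel by left quasi-abelianness.

  For a composite \<open>e d\<close> of deflations \<open>d : B \<rightarrow> D\<close>, \<open>e : D \<rightarrow> F\<close>, let \<open>k : K \<rightarrow> B\<close> be a kernel of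
  \<open>e d\<close>, \<open>j : J \<rightarrow> D\<close> a kernel of \<open>e\<close>, and \<open>d' : K \<rightarrow> J\<close> the pullback of \<open>d\<close> along \<open>j\<close>, with
  kernel \<open>i'\<close>. Then \<open>(k, d') : K \<rightarrow> B \<oplus> J\<close> is the pushout of the inflation \<open>k i'\<close> along \<open>i'\<close>, and
  \<open>1 \<oplus> j : B \<oplus> J \<rightarrow> B \<oplus> D\<close> is a pushout of \<open>j\<close>. Their composite \<open>(k, j d') = (1, d) k\<close> is therefore
  an inflation, and so is \<open>k\<close> by [R3].
\<close>

section \<open>Hom-sets and biproduct data\<close>

lemma Arr_in_Hom: "f \<in> Arr C \<Longrightarrow> f \<in> Hom C (Dom C f) (Cod C f)"
  by (simp add: Hom_def)

lemma HomD: "f \<in> Hom C A B \<Longrightarrow> f \<in> Arr C \<and> Dom C f = A \<and> Cod C f = B"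
  by (simp add: Hom_def)

text \<open>The existential data of \<open>biproduct_exists\<close> as a single predicate, so that
  two biproducts can be fixed and compared across several lemmas.\<close>

definition is_biproduct ::
    "('o, 'm) additive_data \<Rightarrow> 'o \<Rightarrow> 'o \<Rightarrow> 'o \<Rightarrow> 'm \<Rightarrow> 'm \<Rightarrow> 'm \<Rightarrow> 'm \<Rightarrow> bool" where
  "is_biproduct C A B P i1 i2 p1 p2 \<longleftrightarrow>
    i1 \<in> Hom C A P \<and> i2 \<in> Hom C B P \<and> p1 \<in> Hom C P A \<and> p2 \<in> Hom C P B \<and>
    p1 \<cdot>\<^bsub>C\<^esub> i1 = Ident C A \<and> p2 \<cdot>\<^bsub>C\<^esub> i2 = Ident C B \<and>
    p1 \<cdot>\<^bsub>C\<^esub> i2 = Zero C B A \<and> p2 \<cdot>\<^bsub>C\<^esub> i1 = Zero C A B \<and>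
    Plus C (i1 \<cdot>\<^bsub>C\<^esub> p1) (i2 \<cdot>\<^bsub>C\<^esub> p2) = Ident C P"

section \<open>The abelian groups of parallel morphisms\<close>

context additive_category
begin

lemma Hom_Ob:
  assumes "f \<in> Hom C A B"
  shows "A \<in> Ob C" "B \<in> Ob C"
  using assms Dom_in_Ob Cod_in_Ob by (auto simp: Hom_def)

lemma Zero_in_Hom: "\<lbrakk>A \<in> Ob C; B \<in> Ob C\<rbrakk> \<Longrightarrow> Zero C A B \<in> Hom C A B"
  using monoid.one_closed[OF comm_monoid.axioms(1)[OF comm_group.axioms(1)[OF Hom_comm_group]]]
  by simp

lemma Plus_in_Hom:
  assumes "f \<in> Hom C A B" "g \<in> Hom C A B"
  shows "Plus C f g \<in> Hom C A B"
proof -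
  interpret G: comm_group "\<lparr>carrier = Hom C A B, monoid.mult = Plus C, one = Zero C A B\<rparr>"
    using Hom_comm_group Hom_Ob[OF assms(1)] by blast
  show ?thesis using G.m_closed[of f g] assms by simp
qed

lemma Plus_Zero:
  assumes "f \<in> Hom C A B"
  shows "Plus C f (Zero C A B) = f" "Plus C (Zero C A B) f = f"
proof -
  interpret G: comm_group "\<lparr>carrier = Hom C A B, monoid.mult = Plus C, one = Zero C A B\<rparr>"
    using Hom_comm_group Hom_Ob[OF assms(1)] by blast
  show "Plus C f (Zero C A B) = f" "Plus C (Zero C A B) f = f"
    using G.r_one[of f] G.l_one[of f] assms by simp_all
qed

lemma Plus_left_cancel:
  assumes "f \<in> Hom C A B" "g \<in> Hom C A B" "h \<in> Hom C A B" "Plus C f g = Plus C f h"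
  shows "g = h"
proof -
  interpret G: comm_group "\<lparr>carrier = Hom C A B, monoid.mult = Plus C, one = Zero C A B\<rparr>"
    using Hom_comm_group Hom_Ob[OF assms(1)] by blast
  show ?thesis using G.Units_l_cancel[of f g h] assms by (simp add: G.Units_eq)
qed

lemma Plus_right_cancel:
  assumes "f \<in> Hom C A B" "g \<in> Hom C A B" "h \<in> Hom C A B" "Plus C g f = Plus C h f"
  shows "g = h"
proof -
  interpret G: comm_group "\<lparr>carrier = Hom C A B, monoid.mult = Plus C, one = Zero C A B\<rparr>"
    using Hom_comm_group Hom_Ob[OF assms(1)] by blast
  show ?thesis using G.right_cancel[of f g h] assms by simp
qed

text \<open>Stands in for subtraction: it supplies negatives of morphisms in the construction of
  pullbacks and the difference of two morphisms in a pushout computation.\<close>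

lemma difference_exists:
  assumes "f \<in> Hom C A B" "g \<in> Hom C A B"
  shows "\<exists>h \<in> Hom C A B. Plus C f h = g"
proof -
  let ?G = "\<lparr>carrier = Hom C A B, monoid.mult = Plus C, one = Zero C A B\<rparr>"
  interpret G: comm_group ?G
    using Hom_comm_group Hom_Ob[OF assms(1)] by blast
  have "inv\<^bsub>?G\<^esub> f \<in> Hom C A B"
    using G.inv_closed[of f] assms by simp
  moreover from this have "Plus C f (Plus C (inv\<^bsub>?G\<^esub> f) g) = g"
    using G.m_assoc[of f "inv\<^bsub>?G\<^esub> f" g] G.r_inv[of f] assms by (simp add: Plus_Zero)
  ultimately show ?thesis
    using Plus_in_Hom assms(2) by blast
qed

lemma Comp_Zero:
  assumes "f \<in> Hom C B D" "A \<in> Ob C"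
  shows "f \<cdot>\<^bsub>C\<^esub> Zero C A B = Zero C A D"
proof -
  let ?z = "Zero C A B"
  have z: "?z \<in> Hom C A B" and z': "Zero C A D \<in> Hom C A D"
    using Zero_in_Hom assms Hom_Ob by blast+
  have fz: "f \<cdot>\<^bsub>C\<^esub> ?z \<in> Hom C A D"
    using Comp_in_Hom z assms by blast
  have "Plus C (f \<cdot>\<^bsub>C\<^esub> ?z) (f \<cdot>\<^bsub>C\<^esub> ?z) = Plus C (f \<cdot>\<^bsub>C\<^esub> ?z) (Zero C A D)"
    using Comp_Plus[OF z z assms(1)] Plus_Zero[OF z] Plus_Zero[OF fz] by simp
  then show ?thesis
    using Plus_left_cancel fz z' by blast
qed

lemma Zero_Comp:
  assumes "f \<in> Hom C A B" "D \<in> Ob C"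
  shows "Zero C B D \<cdot>\<^bsub>C\<^esub> f = Zero C A D"
proof -
  let ?z = "Zero C B D"
  have z: "?z \<in> Hom C B D" and z': "Zero C A D \<in> Hom C A D"
    using Zero_in_Hom assms Hom_Ob by blast+
  have zf: "?z \<cdot>\<^bsub>C\<^esub> f \<in> Hom C A D"
    using Comp_in_Hom z assms by blast
  have "Plus C (?z \<cdot>\<^bsub>C\<^esub> f) (?z \<cdot>\<^bsub>C\<^esub> f) = Plus C (?z \<cdot>\<^bsub>C\<^esub> f) (Zero C A D)"
    using Plus_Comp[OF assms(1) z z] Plus_Zero[OF z] Plus_Zero[OF zf] by simp
  then show ?thesis
    using Plus_left_cancel zf z' by blast
qed

section \<open>Universal properties of kernels, cokernels, pushouts and pullbacks\<close>

lemma is_kernelI: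
  assumes "f \<in> Hom C B D" "k \<in> Hom C A B" "f \<cdot>\<^bsub>C\<^esub> k = Zero C A D"
    and "\<And>X g. \<lbrakk>g \<in> Hom C X B; f \<cdot>\<^bsub>C\<^esub> g = Zero C X D\<rbrakk> \<Longrightarrow> \<exists>u \<in> Hom C X A. k \<cdot>\<^bsub>C\<^esub> u = g"
    and "\<And>X u v. \<lbrakk>u \<in> Hom C X A; v \<in> Hom C X A; k \<cdot>\<^bsub>C\<^esub> u = k \<cdot>\<^bsub>C\<^esub> v\<rbrakk> \<Longrightarrow> u = v"
  shows "is_kernel C f k"
proof -
  \<comment> \<open>Once \<open>f\<close> and \<open>k\<close> are typed by hom-sets, the conditions
    on \<open>Dom\<close> and \<open>Cod\<close> collapse and only the universal property remains.
    Its uniqueness half is the cancellation law assumed for \<open>k\<close>.\<close>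
  have "?thesis \<longleftrightarrow> (\<forall>X \<in> Ob C. \<forall>g \<in> Hom C X B. f \<cdot>\<^bsub>C\<^esub> g = Zero C X D \<longrightarrow>
      (\<exists>!u. u \<in> Hom C X A \<and> k \<cdot>\<^bsub>C\<^esub> u = g))"
    unfolding is_kernel_def using assms(1-3) HomD[OF assms(1)] HomD[OF assms(2)] by simp
  also have \<dots>
    using assms(4,5) by (intro ballI impI ex_ex1I) blast+
  finally show ?thesis .
qed

lemma is_cokernelI:
  assumes "f \<in> Hom C A B" "d \<in> Hom C B D" "d \<cdot>\<^bsub>C\<^esub> f = Zero C A D"
    and "\<And>X g. \<lbrakk>g \<in> Hom C B X; g \<cdot>\<^bsub>C\<^esub> f = Zero C A X\<rbrakk> \<Longrightarrow> \<exists>u \<in> Hom C D X. u \<cdot>\<^bsub>C\<^esub> d = g"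
    and "\<And>X u v. \<lbrakk>u \<in> Hom C D X; v \<in> Hom C D X; u \<cdot>\<^bsub>C\<^esub> d = v \<cdot>\<^bsub>C\<^esub> d\<rbrakk> \<Longrightarrow> u = v"
  shows "is_cokernel C f d"
proof -
  have "?thesis \<longleftrightarrow> (\<forall>X \<in> Ob C. \<forall>g \<in> Hom C B X. g \<cdot>\<^bsub>C\<^esub> f = Zero C A X \<longrightarrow>
      (\<exists>!u. u \<in> Hom C D X \<and> u \<cdot>\<^bsub>C\<^esub> d = g))"
    unfolding is_cokernel_def using assms(1-3) HomD[OF assms(1)] HomD[OF assms(2)] by simp
  also have \<dots>
    using assms(4,5) by (intro ballI impI ex_ex1I) blast+
  finally show ?thesis .
qed

lemma is_pushoutI:
  assumes "f \<in> Hom C A B" "g \<in> Hom C A A'" "f' \<in> Hom C A' B'" "g' \<in> Hom C B B'"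
    and "g' \<cdot>\<^bsub>C\<^esub> f = f' \<cdot>\<^bsub>C\<^esub> g"
    and "\<And>X a b. \<lbrakk>a \<in> Hom C B X; b \<in> Hom C A' X; a \<cdot>\<^bsub>C\<^esub> f = b \<cdot>\<^bsub>C\<^esub> g\<rbrakk>
      \<Longrightarrow> \<exists>u \<in> Hom C B' X. u \<cdot>\<^bsub>C\<^esub> g' = a \<and> u \<cdot>\<^bsub>C\<^esub> f' = b"
    and "\<And>X u v. \<lbrakk>u \<in> Hom C B' X; v \<in> Hom C B' X; u \<cdot>\<^bsub>C\<^esub> g' = v \<cdot>\<^bsub>C\<^esub> g'; u \<cdot>\<^bsub>C\<^esub> f' = v \<cdot>\<^bsub>C\<^esub> f'\<rbrakk>
      \<Longrightarrow> u = v"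
  shows "is_pushout C f g f' g'"
proof -
  have "?thesis \<longleftrightarrow> (\<forall>X \<in> Ob C. \<forall>a \<in> Hom C B X. \<forall>b \<in> Hom C A' X. a \<cdot>\<^bsub>C\<^esub> f = b \<cdot>\<^bsub>C\<^esub> g \<longrightarrow>
      (\<exists>!u. u \<in> Hom C B' X \<and> u \<cdot>\<^bsub>C\<^esub> g' = a \<and> u \<cdot>\<^bsub>C\<^esub> f' = b))"
    unfolding is_pushout_def using assms(1-5) HomD[OF assms(1)] HomD[OF assms(2)] HomD[OF assms(3)] HomD[OF assms(4)] by simp
  also have \<dots>
    using assms(6) by (intro ballI impI ex_ex1I) (blast, metis assms(7))
  finally show ?thesis .
qed

lemma is_pullbackI:
  assumes "f \<in> Hom C B A" "g \<in> Hom C A' A" "f' \<in> Hom C B' A'" "g' \<in> Hom C B' B"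
    and "f \<cdot>\<^bsub>C\<^esub> g' = g \<cdot>\<^bsub>C\<^esub> f'"
    and "\<And>X a b. \<lbrakk>a \<in> Hom C X B; b \<in> Hom C X A'; f \<cdot>\<^bsub>C\<^esub> a = g \<cdot>\<^bsub>C\<^esub> b\<rbrakk>
      \<Longrightarrow> \<exists>u \<in> Hom C X B'. g' \<cdot>\<^bsub>C\<^esub> u = a \<and> f' \<cdot>\<^bsub>C\<^esub> u = b"
    and "\<And>X u v. \<lbrakk>u \<in> Hom C X B'; v \<in> Hom C X B'; g' \<cdot>\<^bsub>C\<^esub> u = g' \<cdot>\<^bsub>C\<^esub> v; f' \<cdot>\<^bsub>C\<^esub> u = f' \<cdot>\<^bsub>C\<^esub> v\<rbrakk>
      \<Longrightarrow> u = v"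
  shows "is_pullback C f g f' g'"
proof -
  have "?thesis \<longleftrightarrow> (\<forall>X \<in> Ob C. \<forall>a \<in> Hom C X B. \<forall>b \<in> Hom C X A'. f \<cdot>\<^bsub>C\<^esub> a = g \<cdot>\<^bsub>C\<^esub> b \<longrightarrow>
      (\<exists>!u. u \<in> Hom C X B' \<and> g' \<cdot>\<^bsub>C\<^esub> u = a \<and> f' \<cdot>\<^bsub>C\<^esub> u = b))"
    unfolding is_pullback_def using assms(1-5) HomD[OF assms(1)] HomD[OF assms(2)] HomD[OF assms(3)] HomD[OF assms(4)] by simp
  also have \<dots>
    using assms(6) by (intro ballI impI ex_ex1I) (blast, metis assms(7))
  finally show ?thesis .
qed

lemma is_kernelE:
  assumes "is_kernel C f k"
  obtains A B D where "f \<in> Hom C B D" "k \<in> Hom C A B" "f \<cdot>\<^bsub>C\<^esub> k = Zero C A D"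
  using assms unfolding is_kernel_def by (metis Arr_in_Hom)

lemma is_cokernelE:
  assumes "is_cokernel C f d"
  obtains A B D where "f \<in> Hom C A B" "d \<in> Hom C B D" "d \<cdot>\<^bsub>C\<^esub> f = Zero C A D"
  using assms unfolding is_cokernel_def by (metis Arr_in_Hom)

lemma kernel_factor:
  assumes "is_kernel C f k" "f \<in> Hom C B D" "k \<in> Hom C A B"
    and "g \<in> Hom C X B" "f \<cdot>\<^bsub>C\<^esub> g = Zero C X D"
  shows "\<exists>u \<in> Hom C X A. k \<cdot>\<^bsub>C\<^esub> u = g"
proof -
  have "\<exists>!u. u \<in> Hom C X A \<and> k \<cdot>\<^bsub>C\<^esub> u = g"
    using assms(1,4,5) Hom_Ob[OF assms(4)] HomD[OF assms(2)] HomD[OF assms(3)]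
    unfolding is_kernel_def by simp
  then show ?thesis by blast
qed

lemma kernel_monic:
  assumes "is_kernel C f k" "k \<in> Hom C A B"
    and "u \<in> Hom C X A" "v \<in> Hom C X A" "k \<cdot>\<^bsub>C\<^esub> u = k \<cdot>\<^bsub>C\<^esub> v"
  shows "u = v"
proof -
  obtain D where f: "f \<in> Hom C B D" and fk: "f \<cdot>\<^bsub>C\<^esub> k = Zero C A D"
    using assms(1,2) by (metis is_kernelE HomD)
  have kv: "k \<cdot>\<^bsub>C\<^esub> v \<in> Hom C X B"
    using Comp_in_Hom assms by blast
  \<comment> \<open>Since \<open>f\<close> kills \<open>k v\<close>, this morphism factors uniquely
    through \<open>k\<close>, and both \<open>u\<close> and \<open>v\<close> are such
    factorizations.\<close>
  have "f \<cdot>\<^bsub>C\<^esub> (k \<cdot>\<^bsub>C\<^esub> v) = Zero C X D"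
    using Comp_assoc[OF assms(4,2) f] fk Zero_Comp[OF assms(4)] Hom_Ob[OF f] by simp
  then have "\<exists>!w. w \<in> Hom C X A \<and> k \<cdot>\<^bsub>C\<^esub> w = k \<cdot>\<^bsub>C\<^esub> v"
    using assms(1) kv Hom_Ob[OF kv] HomD[OF f] HomD[OF assms(2)] unfolding is_kernel_def by auto
  then show ?thesis using assms by blast
qed

lemma cokernel_factor:
  assumes "is_cokernel C f d" "f \<in> Hom C A B" "d \<in> Hom C B D"
    and "g \<in> Hom C B X" "g \<cdot>\<^bsub>C\<^esub> f = Zero C A X"
  shows "\<exists>u \<in> Hom C D X. u \<cdot>\<^bsub>C\<^esub> d = g"
proof -
  have "\<exists>!u. u \<in> Hom C D X \<and> u \<cdot>\<^bsub>C\<^esub> d = g"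
    using assms(1,4,5) Hom_Ob[OF assms(4)] HomD[OF assms(2)] HomD[OF assms(3)]
    unfolding is_cokernel_def by simp
  then show ?thesis by blast
qed

lemma cokernel_epic:
  assumes "is_cokernel C f d" "d \<in> Hom C B D"
    and "u \<in> Hom C D X" "v \<in> Hom C D X" "u \<cdot>\<^bsub>C\<^esub> d = v \<cdot>\<^bsub>C\<^esub> d"
  shows "u = v"
proof -
  obtain A where f: "f \<in> Hom C A B" and df: "d \<cdot>\<^bsub>C\<^esub> f = Zero C A D"
    using assms(1,2) by (metis is_cokernelE HomD)
  have vd: "v \<cdot>\<^bsub>C\<^esub> d \<in> Hom C B X"
    using Comp_in_Hom assms by blast
  have "(v \<cdot>\<^bsub>C\<^esub> d) \<cdot>\<^bsub>C\<^esub> f = Zero C A X"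
    using Comp_assoc[OF f assms(2,4)] df Comp_Zero[OF assms(4)] Hom_Ob[OF f] by simp
  then have "\<exists>!w. w \<in> Hom C D X \<and> w \<cdot>\<^bsub>C\<^esub> d = v \<cdot>\<^bsub>C\<^esub> d"
    using assms(1) vd Hom_Ob[OF vd] HomD[OF f] HomD[OF assms(2)] unfolding is_cokernel_def by auto
  then show ?thesis using assms by blast
qed

lemma is_pullbackE:
  assumes "is_pullback C f g f' g'"
  obtains A B A' B' where "f \<in> Hom C B A" "g \<in> Hom C A' A" "f' \<in> Hom C B' A'" "g' \<in> Hom C B' B"
    "f \<cdot>\<^bsub>C\<^esub> g' = g \<cdot>\<^bsub>C\<^esub> f'"
proof -
  have "f \<in> Hom C (Dom C f) (Cod C f)" "g \<in> Hom C (Dom C g) (Cod C f)"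
    "f' \<in> Hom C (Dom C f') (Dom C g)" "g' \<in> Hom C (Dom C f') (Dom C f)"
    "f \<cdot>\<^bsub>C\<^esub> g' = g \<cdot>\<^bsub>C\<^esub> f'"
    using assms by (simp_all add: is_pullback_def Hom_def)
  then show thesis using that by blast
qed

lemma pullback_unique_factor:
  assumes "is_pullback C f g f' g'"
    and "f \<in> Hom C B A" "g \<in> Hom C A' A" "f' \<in> Hom C B' A'"
    and "a \<in> Hom C X B" "b \<in> Hom C X A'" "f \<cdot>\<^bsub>C\<^esub> a = g \<cdot>\<^bsub>C\<^esub> b"
  shows "\<exists>!u. u \<in> Hom C X B' \<and> g' \<cdot>\<^bsub>C\<^esub> u = a \<and> f' \<cdot>\<^bsub>C\<^esub> u = b"
proof -
  have "\<forall>X \<in> Ob C. \<forall>a \<in> Hom C X B. \<forall>b \<in> Hom C X A'. f \<cdot>\<^bsub>C\<^esub> a = g \<cdot>\<^bsub>C\<^esub> b \<longrightarrow>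
      (\<exists>!u. u \<in> Hom C X B' \<and> g' \<cdot>\<^bsub>C\<^esub> u = a \<and> f' \<cdot>\<^bsub>C\<^esub> u = b)"
    using assms(1) HomD[OF assms(2)] HomD[OF assms(3)] HomD[OF assms(4)]
    by (simp only: is_pullback_def) blast
  then show ?thesis using assms(5-7) Hom_Ob[OF assms(5)] by blast
qed

lemma pullback_jointly_monic:
  assumes pb: "is_pullback C f g f' g'"
    and f': "f' \<in> Hom C B' A'" and g': "g' \<in> Hom C B' B"
    and u: "u \<in> Hom C X B'" and v: "v \<in> Hom C X B'"
    and eqs: "g' \<cdot>\<^bsub>C\<^esub> u = g' \<cdot>\<^bsub>C\<^esub> v" "f' \<cdot>\<^bsub>C\<^esub> u = f' \<cdot>\<^bsub>C\<^esub> v"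
  shows "u = v"
proof -
  obtain A where f: "f \<in> Hom C B A" and g: "g \<in> Hom C A' A" and sq: "f \<cdot>\<^bsub>C\<^esub> g' = g \<cdot>\<^bsub>C\<^esub> f'"
    using pb f' g' by (metis is_pullbackE HomD)
  \<comment> \<open>The components of \<open>v\<close> form a cone over \<open>f\<close> and
    \<open>g\<close>, and both \<open>u\<close> and \<open>v\<close> induce it.\<close>
  have "f \<cdot>\<^bsub>C\<^esub> (g' \<cdot>\<^bsub>C\<^esub> v) = g \<cdot>\<^bsub>C\<^esub> (f' \<cdot>\<^bsub>C\<^esub> v)"
    using Comp_assoc[OF v g' f] Comp_assoc[OF v f' g] sq by simp
  then show ?thesis
    using pullback_unique_factor[OF pb f g f' Comp_in_Hom[OF v g'] Comp_in_Hom[OF v f']] u v eqs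
    by blast
qed

section \<open>Kernel-cokernel pairs and kernels in pullback squares\<close>

lemma cokernel_of_kernel:
  assumes coker: "is_cokernel C f d" and ker: "is_kernel C d k"
  shows "is_cokernel C k d"
proof -
  obtain A B D where f: "f \<in> Hom C A B" and d: "d \<in> Hom C B D" and df: "d \<cdot>\<^bsub>C\<^esub> f = Zero C A D"
    using is_cokernelE[OF coker] by blast
  obtain K where k: "k \<in> Hom C K B" and dk: "d \<cdot>\<^bsub>C\<^esub> k = Zero C K D"
    using ker d by (metis is_kernelE HomD)
  \<comment> \<open>Since \<open>f\<close> factors through \<open>k\<close>, any morphism that kills
    \<open>k\<close> kills \<open>f\<close> as well, and so descends along \<open>d\<close>.\<close>
  obtain w where w: "w \<in> Hom C A K" and kw: "k \<cdot>\<^bsub>C\<^esub> w = f"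
    using kernel_factor[OF ker d k f df] by blast
  show ?thesis
  proof (rule is_cokernelI[OF k d dk])
    fix X g assume g: "g \<in> Hom C B X" and gk: "g \<cdot>\<^bsub>C\<^esub> k = Zero C K X"
    have "g \<cdot>\<^bsub>C\<^esub> f = Zero C A X"
      using Comp_assoc[OF w k g] gk kw Zero_Comp[OF w] Hom_Ob[OF g] by simp
    then show "\<exists>u \<in> Hom C D X. u \<cdot>\<^bsub>C\<^esub> d = g"
      using cokernel_factor[OF coker f d g] by blast
  next
    fix X u v assume "u \<in> Hom C D X" "v \<in> Hom C D X" "u \<cdot>\<^bsub>C\<^esub> d = v \<cdot>\<^bsub>C\<^esub> d"
    then show "u = v" using cokernel_epic[OF coker d] by blast
  qed
qed

text \<open>Dually, \<open>f\<close> factors through \<open>d\<close>, so whatever \<open>d\<close>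
  kills is killed by \<open>f\<close> and factors through \<open>k\<close>. This turns an inflation
  and its cokernel into a kernel-cokernel pair.\<close>

lemma kernel_of_cokernel:
  assumes ker: "is_kernel C f k" and coker: "is_cokernel C k d"
  shows "is_kernel C d k"
proof -
  obtain A B D where f: "f \<in> Hom C B D" and k: "k \<in> Hom C A B" and fk: "f \<cdot>\<^bsub>C\<^esub> k = Zero C A D"
    using is_kernelE[OF ker] by blast
  obtain E where d: "d \<in> Hom C B E" and dk: "d \<cdot>\<^bsub>C\<^esub> k = Zero C A E"
    using coker k by (metis is_cokernelE HomD)
  obtain w where w: "w \<in> Hom C E D" and wd: "w \<cdot>\<^bsub>C\<^esub> d = f"
    using cokernel_factor[OF coker k d f fk] by blast
  show ?thesis
  proof (rule is_kernelI[OF d k dk])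
    fix X g assume g: "g \<in> Hom C X B" and dg: "d \<cdot>\<^bsub>C\<^esub> g = Zero C X E"
    have "f \<cdot>\<^bsub>C\<^esub> g = Zero C X D"
      using Comp_assoc[OF g d w] dg wd Comp_Zero[OF w] Hom_Ob[OF g] by simp
    then show "\<exists>u \<in> Hom C X A. k \<cdot>\<^bsub>C\<^esub> u = g"
      using kernel_factor[OF ker f k g] by blast
  next
    fix X u v assume "u \<in> Hom C X A" "v \<in> Hom C X A" "k \<cdot>\<^bsub>C\<^esub> u = k \<cdot>\<^bsub>C\<^esub> v"
    then show "u = v" using kernel_monic[OF ker k] by blast
  qed
qed

text \<open>A morphism killed by \<open>d\<close>, paired with the zero morphism into the domain of
  \<open>f\<close>, is a cone. It lifts to the pullback, the lift is killed by \<open>d'\<close>,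
  and hence it factors through \<open>k\<close>.\<close>

lemma pullback_kernel:
  assumes pb: "is_pullback C d f d' f'" and ker: "is_kernel C d' k"
  shows "is_kernel C d (f' \<cdot>\<^bsub>C\<^esub> k)"
proof -
  obtain D B D' B' where d: "d \<in> Hom C B D" and f: "f \<in> Hom C D' D" and d': "d' \<in> Hom C B' D'"
    and f': "f' \<in> Hom C B' B" and sq: "d \<cdot>\<^bsub>C\<^esub> f' = f \<cdot>\<^bsub>C\<^esub> d'"
    by (rule is_pullbackE[OF pb])
  obtain K where k: "k \<in> Hom C K B'" and dk: "d' \<cdot>\<^bsub>C\<^esub> k = Zero C K D'"
    using ker d' by (metis is_kernelE HomD)
  show ?thesis
  proof (rule is_kernelI[OF d Comp_in_Hom[OF k f']])
    show "d \<cdot>\<^bsub>C\<^esub> (f' \<cdot>\<^bsub>C\<^esub> k) = Zero C K D"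
      using Comp_assoc[OF k f' d] Comp_assoc[OF k d' f] sq dk Comp_Zero[OF f] Hom_Ob[OF k] by simp
  next
    fix X g assume g: "g \<in> Hom C X B" and dg: "d \<cdot>\<^bsub>C\<^esub> g = Zero C X D"
    have z: "Zero C X D' \<in> Hom C X D'"
      using Zero_in_Hom Hom_Ob g f by blast
    have "d \<cdot>\<^bsub>C\<^esub> g = f \<cdot>\<^bsub>C\<^esub> Zero C X D'"
      using dg Comp_Zero[OF f] Hom_Ob[OF g] by simp
    then obtain w where w: "w \<in> Hom C X B'" and fw: "f' \<cdot>\<^bsub>C\<^esub> w = g"
      and dw: "d' \<cdot>\<^bsub>C\<^esub> w = Zero C X D'"
      using pullback_unique_factor[OF pb d f d' g z] by blast
    obtain u where u: "u \<in> Hom C X K" and ku: "k \<cdot>\<^bsub>C\<^esub> u = w"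
      using kernel_factor[OF ker d' k w dw] by blast
    show "\<exists>u \<in> Hom C X K. f' \<cdot>\<^bsub>C\<^esub> k \<cdot>\<^bsub>C\<^esub> u = g"
      using u Comp_assoc[OF u k f'] ku fw by auto
  next
    fix X u v assume u: "u \<in> Hom C X K" and v: "v \<in> Hom C X K"
      and eq: "f' \<cdot>\<^bsub>C\<^esub> k \<cdot>\<^bsub>C\<^esub> u = f' \<cdot>\<^bsub>C\<^esub> k \<cdot>\<^bsub>C\<^esub> v"
    \<comment> \<open>Cancelling \<open>f'\<close> alone is not justified, but after composing with
      \<open>d'\<close> both sides vanish, so the joint cancellation law of the pullback
      applies.\<close>
    have "f' \<cdot>\<^bsub>C\<^esub> (k \<cdot>\<^bsub>C\<^esub> u) = f' \<cdot>\<^bsub>C\<^esub> (k \<cdot>\<^bsub>C\<^esub> v)"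
      using Comp_assoc[OF u k f'] Comp_assoc[OF v k f'] eq by simp
    moreover have "d' \<cdot>\<^bsub>C\<^esub> (k \<cdot>\<^bsub>C\<^esub> u) = d' \<cdot>\<^bsub>C\<^esub> (k \<cdot>\<^bsub>C\<^esub> v)"
      using Comp_assoc[OF u k d'] Comp_assoc[OF v k d'] dk Zero_Comp[OF u] Zero_Comp[OF v]
        Hom_Ob[OF d'] by simp
    ultimately have "k \<cdot>\<^bsub>C\<^esub> u = k \<cdot>\<^bsub>C\<^esub> v"
      using pullback_jointly_monic[OF pb d' f'] Comp_in_Hom u v k by blast
    then show "u = v" using kernel_monic[OF ker k u v] by blast
  qed
qed

text \<open>The kernel of \<open>e d\<close> is the preimage under \<open>d\<close> of the kernel of
  \<open>e\<close>: \<open>e d a = 0\<close> holds exactly when \<open>d a\<close> factors through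
  \<open>j\<close>. In this form, facts about pullbacks of \<open>d\<close> apply to the composite
  \<open>e d\<close>.\<close>

lemma kernel_Comp_pullback:
  assumes d: "d \<in> Hom C B D" and e: "e \<in> Hom C D F"
    and kerj: "is_kernel C e j" and kerk: "is_kernel C (e \<cdot>\<^bsub>C\<^esub> d) k"
  shows "\<exists>d'. is_pullback C d j d' k"
proof -
  have ed: "e \<cdot>\<^bsub>C\<^esub> d \<in> Hom C B F"
    using Comp_in_Hom[OF d e] .
  obtain J where j: "j \<in> Hom C J D" and ej: "e \<cdot>\<^bsub>C\<^esub> j = Zero C J F"
    using kerj e by (metis is_kernelE HomD)
  obtain K where k: "k \<in> Hom C K B" and edk: "e \<cdot>\<^bsub>C\<^esub> d \<cdot>\<^bsub>C\<^esub> k = Zero C K F"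
    using kerk ed by (metis is_kernelE HomD)
  have "e \<cdot>\<^bsub>C\<^esub> (d \<cdot>\<^bsub>C\<^esub> k) = Zero C K F"
    using Comp_assoc[OF k d e] edk by simp
  then obtain d' where d': "d' \<in> Hom C K J" and jd: "j \<cdot>\<^bsub>C\<^esub> d' = d \<cdot>\<^bsub>C\<^esub> k"
    using kernel_factor[OF kerj e j Comp_in_Hom[OF k d]] by blast
  have "is_pullback C d j d' k"
  proof (rule is_pullbackI[OF d j d' k])
    show "d \<cdot>\<^bsub>C\<^esub> k = j \<cdot>\<^bsub>C\<^esub> d'" using jd by simp
  next
    fix X a b assume a: "a \<in> Hom C X B" and b: "b \<in> Hom C X J" and ab: "d \<cdot>\<^bsub>C\<^esub> a = j \<cdot>\<^bsub>C\<^esub> b"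
    have "e \<cdot>\<^bsub>C\<^esub> d \<cdot>\<^bsub>C\<^esub> a = Zero C X F"
      using Comp_assoc[OF a d e] Comp_assoc[OF b j e] ab ej Zero_Comp[OF b] Hom_Ob[OF e] by simp
    then obtain u where u: "u \<in> Hom C X K" and ku: "k \<cdot>\<^bsub>C\<^esub> u = a"
      using kernel_factor[OF kerk ed k a] by blast
    have "j \<cdot>\<^bsub>C\<^esub> (d' \<cdot>\<^bsub>C\<^esub> u) = j \<cdot>\<^bsub>C\<^esub> b"
      using Comp_assoc[OF u d' j] Comp_assoc[OF u k d] jd ku ab by simp
    then have "d' \<cdot>\<^bsub>C\<^esub> u = b"
      using kernel_monic[OF kerj j Comp_in_Hom[OF u d'] b] by blast
    then show "\<exists>u \<in> Hom C X K. k \<cdot>\<^bsub>C\<^esub> u = a \<and> d' \<cdot>\<^bsub>C\<^esub> u = b" using u ku by blast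
  next
    fix X u v assume "u \<in> Hom C X K" "v \<in> Hom C X K" "k \<cdot>\<^bsub>C\<^esub> u = k \<cdot>\<^bsub>C\<^esub> v"
    then show "u = v" using kernel_monic[OF kerk k] by blast
  qed
  then show ?thesis ..
qed

section \<open>Biproducts and the pushouts built from them\<close>

lemma is_biproduct_exists:
  assumes "A \<in> Ob C" "B \<in> Ob C"
  shows "\<exists>P i1 i2 p1 p2. is_biproduct C A B P i1 i2 p1 p2"
  using biproduct_exists[OF assms] unfolding is_biproduct_def by blast

lemma biproduct_pair:
  assumes bp: "is_biproduct C A B P i1 i2 p1 p2" and x: "x \<in> Hom C X A" and y: "y \<in> Hom C X B"
  shows "\<exists>u \<in> Hom C X P. p1 \<cdot>\<^bsub>C\<^esub> u = x \<and> p2 \<cdot>\<^bsub>C\<^esub> u = y"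
proof -
  have i1: "i1 \<in> Hom C A P" and i2: "i2 \<in> Hom C B P"
    and p1: "p1 \<in> Hom C P A" and p2: "p2 \<in> Hom C P B"
    and eqs: "p1 \<cdot>\<^bsub>C\<^esub> i1 = Ident C A" "p2 \<cdot>\<^bsub>C\<^esub> i2 = Ident C B"
      "p1 \<cdot>\<^bsub>C\<^esub> i2 = Zero C B A" "p2 \<cdot>\<^bsub>C\<^esub> i1 = Zero C A B"
    using bp by (auto simp: is_biproduct_def)
  let ?u = "Plus C (i1 \<cdot>\<^bsub>C\<^esub> x) (i2 \<cdot>\<^bsub>C\<^esub> y)"
  note ix = Comp_in_Hom[OF x i1] and iy = Comp_in_Hom[OF y i2]
  have "p1 \<cdot>\<^bsub>C\<^esub> ?u = x"
    using Comp_Plus[OF ix iy p1] Comp_assoc[OF x i1 p1] Comp_assoc[OF y i2 p1] eqs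
      Ident_Comp[OF x] Zero_Comp[OF y] Hom_Ob[OF p1] Plus_Zero[OF x] by simp
  moreover have "p2 \<cdot>\<^bsub>C\<^esub> ?u = y"
    using Comp_Plus[OF ix iy p2] Comp_assoc[OF x i1 p2] Comp_assoc[OF y i2 p2] eqs
      Ident_Comp[OF y] Zero_Comp[OF x] Hom_Ob[OF p2] Plus_Zero[OF y] by simp
  ultimately show ?thesis using Plus_in_Hom[OF ix iy] by blast
qed

lemma biproduct_jointly_monic:
  assumes bp: "is_biproduct C A B P i1 i2 p1 p2" and u: "u \<in> Hom C X P" and v: "v \<in> Hom C X P"
    and eq: "p1 \<cdot>\<^bsub>C\<^esub> u = p1 \<cdot>\<^bsub>C\<^esub> v" "p2 \<cdot>\<^bsub>C\<^esub> u = p2 \<cdot>\<^bsub>C\<^esub> v"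
  shows "u = v"
proof -
  have i1: "i1 \<in> Hom C A P" and i2: "i2 \<in> Hom C B P"
    and p1: "p1 \<in> Hom C P A" and p2: "p2 \<in> Hom C P B"
    and id: "Plus C (i1 \<cdot>\<^bsub>C\<^esub> p1) (i2 \<cdot>\<^bsub>C\<^esub> p2) = Ident C P"
    using bp by (auto simp: is_biproduct_def)
  \<comment> \<open>Composing \<open>i1 p1 + i2 p2 = 1\<close> with \<open>w\<close> recovers
    \<open>w\<close> from its two components.\<close>
  have "w = Plus C (i1 \<cdot>\<^bsub>C\<^esub> (p1 \<cdot>\<^bsub>C\<^esub> w)) (i2 \<cdot>\<^bsub>C\<^esub> (p2 \<cdot>\<^bsub>C\<^esub> w))" if w: "w \<in> Hom C X P" for w
    using Plus_Comp[OF w Comp_in_Hom[OF p1 i1] Comp_in_Hom[OF p2 i2]] id Ident_Comp[OF w]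
      Comp_assoc[OF w p1 i1] Comp_assoc[OF w p2 i2] by simp
  then show ?thesis using u v eq by metis
qed

lemma biproduct_copair:
  assumes bp: "is_biproduct C A B P i1 i2 p1 p2" and x: "x \<in> Hom C A X" and y: "y \<in> Hom C B X"
  shows "\<exists>u \<in> Hom C P X. u \<cdot>\<^bsub>C\<^esub> i1 = x \<and> u \<cdot>\<^bsub>C\<^esub> i2 = y"
proof -
  have i1: "i1 \<in> Hom C A P" and i2: "i2 \<in> Hom C B P"
    and p1: "p1 \<in> Hom C P A" and p2: "p2 \<in> Hom C P B"
    and eqs: "p1 \<cdot>\<^bsub>C\<^esub> i1 = Ident C A" "p2 \<cdot>\<^bsub>C\<^esub> i2 = Ident C B"
      "p1 \<cdot>\<^bsub>C\<^esub> i2 = Zero C B A" "p2 \<cdot>\<^bsub>C\<^esub> i1 = Zero C A B"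
    using bp by (auto simp: is_biproduct_def)
  let ?u = "Plus C (x \<cdot>\<^bsub>C\<^esub> p1) (y \<cdot>\<^bsub>C\<^esub> p2)"
  note xp = Comp_in_Hom[OF p1 x] and yp = Comp_in_Hom[OF p2 y]
  have "?u \<cdot>\<^bsub>C\<^esub> i1 = x"
    using Plus_Comp[OF i1 xp yp] Comp_assoc[OF i1 p1 x] Comp_assoc[OF i1 p2 y] eqs
      Comp_Ident[OF x] Comp_Zero[OF y] Hom_Ob[OF i1] Plus_Zero[OF x] by simp
  moreover have "?u \<cdot>\<^bsub>C\<^esub> i2 = y"
    using Plus_Comp[OF i2 xp yp] Comp_assoc[OF i2 p1 x] Comp_assoc[OF i2 p2 y] eqs
      Comp_Ident[OF y] Comp_Zero[OF x] Hom_Ob[OF i2] Plus_Zero[OF y] by simp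
  ultimately show ?thesis using Plus_in_Hom[OF xp yp] by blast
qed

lemma biproduct_jointly_epic:
  assumes bp: "is_biproduct C A B P i1 i2 p1 p2" and u: "u \<in> Hom C P X" and v: "v \<in> Hom C P X"
    and eq: "u \<cdot>\<^bsub>C\<^esub> i1 = v \<cdot>\<^bsub>C\<^esub> i1" "u \<cdot>\<^bsub>C\<^esub> i2 = v \<cdot>\<^bsub>C\<^esub> i2"
  shows "u = v"
proof -
  have i1: "i1 \<in> Hom C A P" and i2: "i2 \<in> Hom C B P"
    and p1: "p1 \<in> Hom C P A" and p2: "p2 \<in> Hom C P B"
    and id: "Plus C (i1 \<cdot>\<^bsub>C\<^esub> p1) (i2 \<cdot>\<^bsub>C\<^esub> p2) = Ident C P"
    using bp by (auto simp: is_biproduct_def)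
  have "w = Plus C (w \<cdot>\<^bsub>C\<^esub> i1 \<cdot>\<^bsub>C\<^esub> p1) (w \<cdot>\<^bsub>C\<^esub> i2 \<cdot>\<^bsub>C\<^esub> p2)" if w: "w \<in> Hom C P X" for w
    using Comp_Plus[OF Comp_in_Hom[OF p1 i1] Comp_in_Hom[OF p2 i2] w] id Comp_Ident[OF w]
      Comp_assoc[OF p1 i1 w] Comp_assoc[OF p2 i2 w] by simp
  then show ?thesis using u v eq by metis
qed

text \<open>The equations on the two injections say that \<open>t\<close> is
  \<open>1 \<oplus> j\<close>. Pushing \<open>j\<close> out along \<open>i2\<close> only adjoins the
  summand \<open>B\<close>, so [R2] makes \<open>1 \<oplus> j\<close> an inflation whenever
  \<open>j\<close> is one.\<close>

lemma biproduct_pushout: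
  assumes bp: "is_biproduct C B J P i1 i2 p1 p2" and bq: "is_biproduct C B D Q j1 j2 q1 q2"
    and j: "j \<in> Hom C J D" and t: "t \<in> Hom C P Q"
    and t1: "t \<cdot>\<^bsub>C\<^esub> i1 = j1" and t2: "t \<cdot>\<^bsub>C\<^esub> i2 = j2 \<cdot>\<^bsub>C\<^esub> j"
  shows "is_pushout C j i2 t j2"
proof -
  have i1: "i1 \<in> Hom C B P" and i2: "i2 \<in> Hom C J P"
    and j1: "j1 \<in> Hom C B Q" and j2: "j2 \<in> Hom C D Q"
    using bp bq by (auto simp: is_biproduct_def)
  show ?thesis
  proof (rule is_pushoutI[OF j i2 t j2])
    show "j2 \<cdot>\<^bsub>C\<^esub> j = t \<cdot>\<^bsub>C\<^esub> i2" using t2 by simp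
  next
    fix X a b assume a: "a \<in> Hom C D X" and b: "b \<in> Hom C P X" and ab: "a \<cdot>\<^bsub>C\<^esub> j = b \<cdot>\<^bsub>C\<^esub> i2"
    \<comment> \<open>The induced morphism is forced on both summands of \<open>Q\<close>: by
      \<open>b i1\<close> on \<open>B\<close>, because \<open>t i1 = j1\<close>, and by
      \<open>a\<close> on \<open>D\<close>.\<close>
    obtain u where u: "u \<in> Hom C Q X" and u1: "u \<cdot>\<^bsub>C\<^esub> j1 = b \<cdot>\<^bsub>C\<^esub> i1" and u2: "u \<cdot>\<^bsub>C\<^esub> j2 = a"
      using biproduct_copair[OF bq Comp_in_Hom[OF i1 b] a] by blast
    have "u \<cdot>\<^bsub>C\<^esub> t \<cdot>\<^bsub>C\<^esub> i1 = b \<cdot>\<^bsub>C\<^esub> i1"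
      using Comp_assoc[OF i1 t u] t1 u1 by simp
    moreover have "u \<cdot>\<^bsub>C\<^esub> t \<cdot>\<^bsub>C\<^esub> i2 = b \<cdot>\<^bsub>C\<^esub> i2"
      using Comp_assoc[OF i2 t u] Comp_assoc[OF j j2 u] t2 u2 ab by simp
    ultimately have "u \<cdot>\<^bsub>C\<^esub> t = b"
      using biproduct_jointly_epic[OF bp Comp_in_Hom[OF t u] b] by blast
    then show "\<exists>u \<in> Hom C Q X. u \<cdot>\<^bsub>C\<^esub> j2 = a \<and> u \<cdot>\<^bsub>C\<^esub> t = b" using u u2 by blast
  next
    fix X u v assume u: "u \<in> Hom C Q X" and v: "v \<in> Hom C Q X"
      and eq: "u \<cdot>\<^bsub>C\<^esub> j2 = v \<cdot>\<^bsub>C\<^esub> j2" "u \<cdot>\<^bsub>C\<^esub> t = v \<cdot>\<^bsub>C\<^esub> t"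
    have "u \<cdot>\<^bsub>C\<^esub> j1 = v \<cdot>\<^bsub>C\<^esub> j1"
      using Comp_assoc[OF i1 t u] Comp_assoc[OF i1 t v] t1 eq(2) by simp
    then show "u = v" using biproduct_jointly_epic[OF bq u v] eq(1) by blast
  qed
qed

text \<open>Here \<open>s\<close> is \<open>(k, d)\<close>. A compatible pair satisfies
  \<open>a k i = b i\<close>, so \<open>b - a k\<close> kills \<open>i\<close> and equals
  \<open>w d\<close> for some \<open>w\<close>. The induced morphism on \<open>B \<oplus> J\<close>
  then has components \<open>a\<close> and \<open>w\<close>.\<close>

lemma cokernel_pushout_biproduct:
  assumes coker: "is_cokernel C i d" and i: "i \<in> Hom C A K" and d: "d \<in> Hom C K J"
    and k: "k \<in> Hom C K B" and bp: "is_biproduct C B J P i1 i2 p1 p2"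
    and s: "s \<in> Hom C K P" and s1: "p1 \<cdot>\<^bsub>C\<^esub> s = k" and s2: "p2 \<cdot>\<^bsub>C\<^esub> s = d"
  shows "is_pushout C (k \<cdot>\<^bsub>C\<^esub> i) i s i1"
proof -
  have i1: "i1 \<in> Hom C B P" and i2: "i2 \<in> Hom C J P"
    and p1: "p1 \<in> Hom C P B" and p2: "p2 \<in> Hom C P J"
    and eqs: "p1 \<cdot>\<^bsub>C\<^esub> i1 = Ident C B" "p2 \<cdot>\<^bsub>C\<^esub> i1 = Zero C B J"
      "Plus C (i1 \<cdot>\<^bsub>C\<^esub> p1) (i2 \<cdot>\<^bsub>C\<^esub> p2) = Ident C P"
    using bp by (auto simp: is_biproduct_def)
  have di: "d \<cdot>\<^bsub>C\<^esub> i = Zero C A J"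
    using coker i d by (metis is_cokernelE HomD)
  have ki: "k \<cdot>\<^bsub>C\<^esub> i \<in> Hom C A B"
    using Comp_in_Hom[OF i k] .
  have s_eq: "s = Plus C (i1 \<cdot>\<^bsub>C\<^esub> k) (i2 \<cdot>\<^bsub>C\<^esub> d)"
    using Plus_Comp[OF s Comp_in_Hom[OF p1 i1] Comp_in_Hom[OF p2 i2]] eqs(3) Ident_Comp[OF s]
      Comp_assoc[OF s p1 i1] Comp_assoc[OF s p2 i2] s1 s2 by simp
  have us: "u \<cdot>\<^bsub>C\<^esub> s = Plus C (u \<cdot>\<^bsub>C\<^esub> i1 \<cdot>\<^bsub>C\<^esub> k) (u \<cdot>\<^bsub>C\<^esub> i2 \<cdot>\<^bsub>C\<^esub> d)" if u: "u \<in> Hom C P X" for u X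
    using Comp_Plus[OF Comp_in_Hom[OF k i1] Comp_in_Hom[OF d i2] u] s_eq
      Comp_assoc[OF k i1 u] Comp_assoc[OF d i2 u] by simp
  show ?thesis
  proof (rule is_pushoutI[OF ki i s i1])
    \<comment> \<open>Both sides have components \<open>k i\<close> and \<open>0\<close>, the latter
      because \<open>d i = 0\<close>.\<close>
    show "i1 \<cdot>\<^bsub>C\<^esub> (k \<cdot>\<^bsub>C\<^esub> i) = s \<cdot>\<^bsub>C\<^esub> i"
    proof (rule biproduct_jointly_monic[OF bp Comp_in_Hom[OF ki i1] Comp_in_Hom[OF i s]])
      show "p1 \<cdot>\<^bsub>C\<^esub> (i1 \<cdot>\<^bsub>C\<^esub> (k \<cdot>\<^bsub>C\<^esub> i)) = p1 \<cdot>\<^bsub>C\<^esub> (s \<cdot>\<^bsub>C\<^esub> i)"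
        using Comp_assoc[OF ki i1 p1] Comp_assoc[OF i s p1] eqs(1) Ident_Comp[OF ki] s1 by simp
      show "p2 \<cdot>\<^bsub>C\<^esub> (i1 \<cdot>\<^bsub>C\<^esub> (k \<cdot>\<^bsub>C\<^esub> i)) = p2 \<cdot>\<^bsub>C\<^esub> (s \<cdot>\<^bsub>C\<^esub> i)"
        using Comp_assoc[OF ki i1 p2] Comp_assoc[OF i s p2] eqs(2) Zero_Comp[OF ki] Hom_Ob[OF d]
          s2 di by simp
    qed
  next
    fix X a b assume a: "a \<in> Hom C B X" and b: "b \<in> Hom C K X"
      and ab: "a \<cdot>\<^bsub>C\<^esub> (k \<cdot>\<^bsub>C\<^esub> i) = b \<cdot>\<^bsub>C\<^esub> i"
    note ak = Comp_in_Hom[OF k a]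
    \<comment> \<open>\<open>c\<close> is the difference \<open>b - a k\<close>.\<close>
    obtain c where c: "c \<in> Hom C K X" and akc: "Plus C (a \<cdot>\<^bsub>C\<^esub> k) c = b"
      using difference_exists[OF ak b] by blast
    note aki = Comp_in_Hom[OF i ak]
    have z: "Zero C A X \<in> Hom C A X"
      using Zero_in_Hom Hom_Ob[OF aki] by blast
    have "Plus C (a \<cdot>\<^bsub>C\<^esub> k \<cdot>\<^bsub>C\<^esub> i) (c \<cdot>\<^bsub>C\<^esub> i) = Plus C (a \<cdot>\<^bsub>C\<^esub> k \<cdot>\<^bsub>C\<^esub> i) (Zero C A X)"
      using Plus_Comp[OF i ak c] akc ab Comp_assoc[OF i k a] Plus_Zero[OF aki] by simp
    then have "c \<cdot>\<^bsub>C\<^esub> i = Zero C A X"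
      using Plus_left_cancel[OF aki Comp_in_Hom[OF i c] z] by blast
    then obtain w where w: "w \<in> Hom C J X" and wd: "w \<cdot>\<^bsub>C\<^esub> d = c"
      using cokernel_factor[OF coker i d c] by blast
    obtain u where u: "u \<in> Hom C P X" and u12: "u \<cdot>\<^bsub>C\<^esub> i1 = a" "u \<cdot>\<^bsub>C\<^esub> i2 = w"
      using biproduct_copair[OF bp a w] by blast
    have "u \<cdot>\<^bsub>C\<^esub> s = b" using us[OF u] u12 wd akc by simp
    then show "\<exists>u \<in> Hom C P X. u \<cdot>\<^bsub>C\<^esub> i1 = a \<and> u \<cdot>\<^bsub>C\<^esub> s = b" using u u12 by blast
  next
    fix X u v assume u: "u \<in> Hom C P X" and v: "v \<in> Hom C P X"
      and eq: "u \<cdot>\<^bsub>C\<^esub> i1 = v \<cdot>\<^bsub>C\<^esub> i1" "u \<cdot>\<^bsub>C\<^esub> s = v \<cdot>\<^bsub>C\<^esub> s"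
    note ui = Comp_in_Hom[OF i1 u] Comp_in_Hom[OF i2 u] and vi = Comp_in_Hom[OF i2 v]
    \<comment> \<open>In the expansions of \<open>u s\<close> and \<open>v s\<close> the summands
      through \<open>i1 k\<close> agree and can be cancelled.\<close>
    have "u \<cdot>\<^bsub>C\<^esub> i2 \<cdot>\<^bsub>C\<^esub> d = v \<cdot>\<^bsub>C\<^esub> i2 \<cdot>\<^bsub>C\<^esub> d"
      using Plus_left_cancel[OF Comp_in_Hom[OF k ui(1)] Comp_in_Hom[OF d ui(2)]
          Comp_in_Hom[OF d vi]] us[OF u] us[OF v] eq by simp
    then have "u \<cdot>\<^bsub>C\<^esub> i2 = v \<cdot>\<^bsub>C\<^esub> i2"
      using cokernel_epic[OF coker d ui(2) vi] by blast
    then show "u = v" using biproduct_jointly_epic[OF bp u v] eq(1) by blast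
  qed
qed

end

section \<open>Pullbacks and composites of cokernels\<close>

lemma (in pre_abelian_category) pullback_exists:
  assumes d: "d \<in> Hom C B D" and f: "f \<in> Hom C D' D"
  shows "\<exists>d' f'. is_pullback C d f d' f'"
proof -
  obtain P i1 i2 p1 p2 where bp: "is_biproduct C B D' P i1 i2 p1 p2"
    using is_biproduct_exists Hom_Ob[OF d] Hom_Ob[OF f] by metis
  then have p1: "p1 \<in> Hom C P B" and p2: "p2 \<in> Hom C P D'"
    by (auto simp: is_biproduct_def)
  \<comment> \<open>\<open>n\<close> is \<open>-f\<close>, so \<open>h\<close> below is
    \<open>d p1 - f p2\<close>. Its kernel, followed by the two projections, is the
    pullback.\<close>
  obtain n where n: "n \<in> Hom C D' D" and fn: "Plus C f n = Zero C D' D"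
    using difference_exists[OF f Zero_in_Hom] Hom_Ob[OF f] by blast
  define h where "h = Plus C (d \<cdot>\<^bsub>C\<^esub> p1) (n \<cdot>\<^bsub>C\<^esub> p2)"
  note dp = Comp_in_Hom[OF p1 d] and np = Comp_in_Hom[OF p2 n]
  have h: "h \<in> Hom C P D"
    unfolding h_def using Plus_in_Hom[OF dp np] .
  have h_zero: "h \<cdot>\<^bsub>C\<^esub> x = Zero C X D \<longleftrightarrow> d \<cdot>\<^bsub>C\<^esub> (p1 \<cdot>\<^bsub>C\<^esub> x) = f \<cdot>\<^bsub>C\<^esub> (p2 \<cdot>\<^bsub>C\<^esub> x)"
    if x: "x \<in> Hom C X P" for x X
  proof -
    note p1x = Comp_in_Hom[OF x p1] and p2x = Comp_in_Hom[OF x p2]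
    have "h \<cdot>\<^bsub>C\<^esub> x = Plus C (d \<cdot>\<^bsub>C\<^esub> (p1 \<cdot>\<^bsub>C\<^esub> x)) (n \<cdot>\<^bsub>C\<^esub> (p2 \<cdot>\<^bsub>C\<^esub> x))"
      unfolding h_def using Plus_Comp[OF x dp np] Comp_assoc[OF x p1 d] Comp_assoc[OF x p2 n] by simp
    \<comment> \<open>Zero is rewritten as \<open>(f + n) p2 x\<close>. Cancelling the common
      summand \<open>n p2 x\<close> then turns the vanishing of \<open>h x\<close> into the equality
      of the two legs.\<close>
    moreover have "Zero C X D = Plus C (f \<cdot>\<^bsub>C\<^esub> (p2 \<cdot>\<^bsub>C\<^esub> x)) (n \<cdot>\<^bsub>C\<^esub> (p2 \<cdot>\<^bsub>C\<^esub> x))"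
      using Plus_Comp[OF p2x f n] fn Zero_Comp[OF p2x] Hom_Ob[OF f] by simp
    ultimately show ?thesis
      using Plus_right_cancel[OF Comp_in_Hom[OF p2x n] Comp_in_Hom[OF p1x d] Comp_in_Hom[OF p2x f]]
      by auto
  qed
  obtain k where ker: "is_kernel C h k"
    using kernel_exists HomD[OF h] by blast
  then obtain K where k: "k \<in> Hom C K P" and hk: "h \<cdot>\<^bsub>C\<^esub> k = Zero C K D"
    using h by (metis is_kernelE HomD)
  have "is_pullback C d f (p2 \<cdot>\<^bsub>C\<^esub> k) (p1 \<cdot>\<^bsub>C\<^esub> k)"
  proof (rule is_pullbackI[OF d f Comp_in_Hom[OF k p2] Comp_in_Hom[OF k p1]])
    show "d \<cdot>\<^bsub>C\<^esub> (p1 \<cdot>\<^bsub>C\<^esub> k) = f \<cdot>\<^bsub>C\<^esub> (p2 \<cdot>\<^bsub>C\<^esub> k)" using h_zero[OF k] hk by blast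
  next
    fix X a b assume a: "a \<in> Hom C X B" and b: "b \<in> Hom C X D'" and ab: "d \<cdot>\<^bsub>C\<^esub> a = f \<cdot>\<^bsub>C\<^esub> b"
    obtain x where x: "x \<in> Hom C X P" and px: "p1 \<cdot>\<^bsub>C\<^esub> x = a" "p2 \<cdot>\<^bsub>C\<^esub> x = b"
      using biproduct_pair[OF bp a b] by blast
    obtain u where u: "u \<in> Hom C X K" and ku: "k \<cdot>\<^bsub>C\<^esub> u = x"
      using kernel_factor[OF ker h k x] h_zero[OF x] px ab by blast
    show "\<exists>u \<in> Hom C X K. p1 \<cdot>\<^bsub>C\<^esub> k \<cdot>\<^bsub>C\<^esub> u = a \<and> p2 \<cdot>\<^bsub>C\<^esub> k \<cdot>\<^bsub>C\<^esub> u = b"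
      using u Comp_assoc[OF u k p1] Comp_assoc[OF u k p2] ku px by auto
  next
    fix X u v assume u: "u \<in> Hom C X K" and v: "v \<in> Hom C X K"
      and eq: "p1 \<cdot>\<^bsub>C\<^esub> k \<cdot>\<^bsub>C\<^esub> u = p1 \<cdot>\<^bsub>C\<^esub> k \<cdot>\<^bsub>C\<^esub> v" "p2 \<cdot>\<^bsub>C\<^esub> k \<cdot>\<^bsub>C\<^esub> u = p2 \<cdot>\<^bsub>C\<^esub> k \<cdot>\<^bsub>C\<^esub> v"
    have "k \<cdot>\<^bsub>C\<^esub> u = k \<cdot>\<^bsub>C\<^esub> v"
      using biproduct_jointly_monic[OF bp Comp_in_Hom[OF u k] Comp_in_Hom[OF v k]] eq
        Comp_assoc[OF u k p1] Comp_assoc[OF v k p1] Comp_assoc[OF u k p2] Comp_assoc[OF v k p2]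
      by simp
    then show "u = v" using kernel_monic[OF ker k u v] by blast
  qed
  then show ?thesis by blast
qed

text \<open>A morphism \<open>g\<close> with \<open>g k = 0\<close> also kills the kernel of
  \<open>d\<close>, which factors through \<open>k\<close>, so \<open>g = h d\<close>. Then
  \<open>h j d' = h d k = g k = 0\<close>. As a pullback of a cokernel, \<open>d'\<close> is epic,
  so \<open>h j = 0\<close> and \<open>h\<close> descends along \<open>e\<close>.\<close>

lemma (in left_quasi_abelian_category) cokernel_Comp:
  assumes cd: "is_cokernel C f d" and ce: "is_cokernel C g e"
    and d: "d \<in> Hom C B D" and e: "e \<in> Hom C D F" and kerk: "is_kernel C (e \<cdot>\<^bsub>C\<^esub> d) k"
  shows "is_cokernel C k (e \<cdot>\<^bsub>C\<^esub> d)"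
proof -
  have ed: "e \<cdot>\<^bsub>C\<^esub> d \<in> Hom C B F"
    using Comp_in_Hom[OF d e] .
  obtain K where k: "k \<in> Hom C K B" and edk: "e \<cdot>\<^bsub>C\<^esub> d \<cdot>\<^bsub>C\<^esub> k = Zero C K F"
    using kerk ed by (metis is_kernelE HomD)
  obtain j where kerj: "is_kernel C e j"
    using kernel_exists HomD[OF e] by blast
  then obtain J where j: "j \<in> Hom C J D"
    using e by (metis is_kernelE HomD)
  obtain d' where pb: "is_pullback C d j d' k"
    using kernel_Comp_pullback[OF d e kerj kerk] by blast
  then have d': "d' \<in> Hom C K J" and sq: "d \<cdot>\<^bsub>C\<^esub> k = j \<cdot>\<^bsub>C\<^esub> d'"
    using j k by (metis is_pullbackE HomD)+
  obtain f' where cd': "is_cokernel C f' d'"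
    using cokernel_pullback[OF _ pb] cd by blast
  obtain i where keri: "is_kernel C d i"
    using kernel_exists HomD[OF d] by blast
  then obtain A where i: "i \<in> Hom C A B" and di: "d \<cdot>\<^bsub>C\<^esub> i = Zero C A D"
    using d by (metis is_kernelE HomD)
  have "e \<cdot>\<^bsub>C\<^esub> d \<cdot>\<^bsub>C\<^esub> i = Zero C A F"
    using Comp_assoc[OF i d e] di Comp_Zero[OF e] Hom_Ob[OF i] by simp
  then obtain w where w: "w \<in> Hom C A K" and kw: "k \<cdot>\<^bsub>C\<^esub> w = i"
    using kernel_factor[OF kerk ed k i] by blast
  show ?thesis
  proof (rule is_cokernelI[OF k ed edk])
    fix X g assume g: "g \<in> Hom C B X" and gk: "g \<cdot>\<^bsub>C\<^esub> k = Zero C K X"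
    have X: "X \<in> Ob C" using Hom_Ob[OF g] by blast
    have "g \<cdot>\<^bsub>C\<^esub> i = Zero C A X"
      using Comp_assoc[OF w k g] kw gk Zero_Comp[OF w X] by simp
    then obtain h where h: "h \<in> Hom C D X" and hd: "h \<cdot>\<^bsub>C\<^esub> d = g"
      using cokernel_factor[OF cokernel_of_kernel[OF cd keri] i d g] by blast
    have z: "Zero C J X \<in> Hom C J X"
      using Zero_in_Hom Hom_Ob[OF j] X by blast
    have "h \<cdot>\<^bsub>C\<^esub> j \<cdot>\<^bsub>C\<^esub> d' = Zero C J X \<cdot>\<^bsub>C\<^esub> d'"
      using Comp_assoc[OF d' j h] Comp_assoc[OF k d h] sq hd gk Zero_Comp[OF d' X] by simp
    then have "h \<cdot>\<^bsub>C\<^esub> j = Zero C J X"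
      using cokernel_epic[OF cd' d' Comp_in_Hom[OF j h] z] by blast
    then obtain u where u: "u \<in> Hom C F X" and ue: "u \<cdot>\<^bsub>C\<^esub> e = h"
      using cokernel_factor[OF cokernel_of_kernel[OF ce kerj] j e h] by blast
    then show "\<exists>u \<in> Hom C F X. u \<cdot>\<^bsub>C\<^esub> (e \<cdot>\<^bsub>C\<^esub> d) = g"
      using Comp_assoc[OF d e u] hd by auto
  next
    fix X u v assume u: "u \<in> Hom C F X" and v: "v \<in> Hom C F X"
      and eq: "u \<cdot>\<^bsub>C\<^esub> (e \<cdot>\<^bsub>C\<^esub> d) = v \<cdot>\<^bsub>C\<^esub> (e \<cdot>\<^bsub>C\<^esub> d)"
    have "u \<cdot>\<^bsub>C\<^esub> e = v \<cdot>\<^bsub>C\<^esub> e"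
      using cokernel_epic[OF cd d Comp_in_Hom[OF e u] Comp_in_Hom[OF e v]] eq
        Comp_assoc[OF d e u] Comp_assoc[OF d e v] by simp
    then show "u = v" using cokernel_epic[OF ce e u v] by blast
  qed
qed

section \<open>The deflations of a right exact structure\<close>

context right_exact_structure
begin

text \<open>These are the second components of the conflations, hence the only candidate for the
  deflations of a left exact structure with the same conflations.\<close>

definition deflations :: "'m set" where
  "deflations = {d. \<exists>i \<in> Infl. is_cokernel C i d}"

lemma Ident_zero_deflation:
  assumes Z: "zero_object C Z"
  shows "Ident C Z \<in> deflations"
proof -
  have ZO: "Z \<in> Ob C" and uniq: "\<And>f g. \<lbrakk>f \<in> Hom C Z Z; g \<in> Hom C Z Z\<rbrakk> \<Longrightarrow> f = g"
    using Z by (auto simp: zero_object_def)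
  have id: "Ident C Z \<in> Hom C Z Z"
    using Ident_in_Hom ZO by blast
  \<comment> \<open>The identity of a zero object is also the zero morphism, so it is its own
    cokernel.\<close>
  have "is_cokernel C (Ident C Z) (Ident C Z)"
  proof (rule is_cokernelI[OF id id])
    show "Ident C Z \<cdot>\<^bsub>C\<^esub> Ident C Z = Zero C Z Z"
      using uniq Comp_in_Hom[OF id id] Zero_in_Hom[OF ZO ZO] by blast
  qed (use Comp_Ident in auto)
  then show ?thesis using R0[OF Z] by (auto simp: deflations_def)
qed

text \<open>A deflation has some inflation \<open>i0\<close> as a kernel, and any other kernel
  \<open>i\<close> differs from it by an isomorphism \<open>s\<close>. Closure of inflations under
  such isomorphisms comes from [R2], because \<open>i\<close> is a pushout of \<open>i0\<close>
  along \<open>s\<close>.\<close>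

lemma kernel_of_deflation:
  assumes d: "d \<in> deflations" and keri: "is_kernel C d i"
  shows "i \<in> Infl"
proof -
  obtain i0 where i0I: "i0 \<in> Infl" and cd: "is_cokernel C i0 d"
    using d by (auto simp: deflations_def)
  have ker0: "is_kernel C d i0"
    using inflation_is_kernel[OF i0I] kernel_of_cokernel cd by blast
  obtain A0 B D where d: "d \<in> Hom C B D" and i0: "i0 \<in> Hom C A0 B" "d \<cdot>\<^bsub>C\<^esub> i0 = Zero C A0 D"
    using is_kernelE[OF ker0] by blast
  obtain A where i: "i \<in> Hom C A B" "d \<cdot>\<^bsub>C\<^esub> i = Zero C A D"
    using keri d by (metis is_kernelE HomD)
  obtain s where s: "s \<in> Hom C A0 A" and is': "i \<cdot>\<^bsub>C\<^esub> s = i0"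
    using kernel_factor[OF keri d i(1) i0] by blast
  obtain t where t: "t \<in> Hom C A A0" and it: "i0 \<cdot>\<^bsub>C\<^esub> t = i"
    using kernel_factor[OF ker0 d i0(1) i] by blast
  have AO: "A \<in> Ob C" and BO: "B \<in> Ob C" using Hom_Ob[OF i(1)] by blast+
  \<comment> \<open>The equation \<open>s t = 1\<close> yields the pushout property:
    \<open>a i0 = b s\<close> implies \<open>a i = a i0 t = b s t = b\<close>.\<close>
  have "i \<cdot>\<^bsub>C\<^esub> (s \<cdot>\<^bsub>C\<^esub> t) = i \<cdot>\<^bsub>C\<^esub> Ident C A"
    using Comp_assoc[OF t s i(1)] is' it Comp_Ident[OF i(1)] by simp
  then have st: "s \<cdot>\<^bsub>C\<^esub> t = Ident C A"
    using kernel_monic[OF keri i(1) Comp_in_Hom[OF t s] Ident_in_Hom[OF AO]] by blast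
  have "is_pushout C i0 s i (Ident C B)"
  proof (rule is_pushoutI[OF i0(1) s i(1) Ident_in_Hom[OF BO]])
    show "Ident C B \<cdot>\<^bsub>C\<^esub> i0 = i \<cdot>\<^bsub>C\<^esub> s" using Ident_Comp[OF i0(1)] is' by simp
  next
    fix X a b assume a: "a \<in> Hom C B X" and b: "b \<in> Hom C A X" and ab: "a \<cdot>\<^bsub>C\<^esub> i0 = b \<cdot>\<^bsub>C\<^esub> s"
    have "a \<cdot>\<^bsub>C\<^esub> i = b"
      using Comp_assoc[OF t i0(1) a] Comp_assoc[OF t s b] it ab st Comp_Ident[OF b] by simp
    then show "\<exists>u \<in> Hom C B X. u \<cdot>\<^bsub>C\<^esub> Ident C B = a \<and> u \<cdot>\<^bsub>C\<^esub> i = b"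
      using a Comp_Ident[OF a] by blast
  next
    fix X u v assume "u \<in> Hom C B X" "v \<in> Hom C B X" "u \<cdot>\<^bsub>C\<^esub> Ident C B = v \<cdot>\<^bsub>C\<^esub> Ident C B"
    then show "u = v" using Comp_Ident by metis
  qed
  then show ?thesis using R2_inflation[OF i0I] by blast
qed

text \<open>From left to right, every kernel of a deflation is an inflation, and a cokernel is the
  cokernel of its kernel. From right to left, an inflation is the kernel of its cokernel.\<close>

lemma left_conflations_deflations: "left_conflations C deflations = right_conflations C Infl"
proof (intro equalityI subrelI)
  fix i d assume "(i, d) \<in> left_conflations C deflations"
  then have d: "d \<in> deflations" and ker: "is_kernel C d i"
    by (auto simp: left_conflations_def)
  then show "(i, d) \<in> right_conflations C Infl"
    using kernel_of_deflation cokernel_of_kernel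
    by (auto simp: right_conflations_def deflations_def)
next
  fix i d assume "(i, d) \<in> right_conflations C Infl"
  then have i: "i \<in> Infl" and coker: "is_cokernel C i d"
    by (auto simp: right_conflations_def)
  then show "(i, d) \<in> left_conflations C deflations"
    using inflation_is_kernel[OF i] kernel_of_cokernel
    by (auto simp: left_conflations_def deflations_def)
qed

end

section \<open>Left exactness of the deflations\<close>

locale left_quasi_abelian_strongly_right_exact =
  left_quasi_abelian_category C + strongly_right_exact_structure C Infl
  for C :: "('o, 'm) additive_data" and Infl :: "'m set"
begin

text \<open>In a pre-abelian category the cokernel demanded by [R3] always exists, which leaves a
  plain cancellation law for inflations.\<close>

lemma inflation_cancel:
  assumes "i \<in> Hom C A B" "p \<in> Hom C B D" "p \<cdot>\<^bsub>C\<^esub> i \<in> Infl"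
  shows "i \<in> Infl"
  using R3[of i p] assms cokernel_exists HomD[OF assms(1)] HomD[OF assms(2)] by simp

lemma pullback_deflation:
  assumes d: "d \<in> deflations" and pb: "is_pullback C d f d' f'"
  shows "d' \<in> deflations"
proof -
  obtain B' B D' where d': "d' \<in> Hom C B' D'" and f': "f' \<in> Hom C B' B"
    using is_pullbackE[OF pb] by blast
  obtain k where ker: "is_kernel C d' k"
    using kernel_exists HomD[OF d'] by blast
  then obtain K where k: "k \<in> Hom C K B'"
    using d' by (metis is_kernelE HomD)
  have "f' \<cdot>\<^bsub>C\<^esub> k \<in> Infl"
    using kernel_of_deflation[OF d pullback_kernel[OF pb ker]] .
  then have "k \<in> Infl"
    using inflation_cancel[OF k f'] by blast
  \<comment> \<open>Left quasi-abelianness makes \<open>d'\<close> a cokernel of some morphism, and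
    therefore of its own kernel \<open>k\<close>.\<close>
  moreover have "is_cokernel C k d'"
    using cokernel_pullback[OF _ pb] d cokernel_of_kernel[OF _ ker] by (auto simp: deflations_def)
  ultimately show ?thesis by (auto simp: deflations_def)
qed

text \<open>To apply [R3] to \<open>k\<close>, an inflation with first factor \<open>k\<close> is
  required. The composite \<open>d k = j d'\<close> need not be one, since it kills the kernel of
  \<open>d'\<close>; adding the component in \<open>B\<close> repairs this, which is why the
  argument passes through \<open>B \<oplus> D\<close>.\<close>

lemma Comp_deflation:
  assumes dD: "d \<in> deflations" and eD: "e \<in> deflations" and cod: "Cod C d = Dom C e"
  shows "e \<cdot>\<^bsub>C\<^esub> d \<in> deflations"
proof -
  obtain f g where cd: "is_cokernel C f d" and ce: "is_cokernel C g e"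
    using dD eD by (auto simp: deflations_def)
  obtain B D where d: "d \<in> Hom C B D" using is_cokernelE[OF cd] by blast
  obtain F where e: "e \<in> Hom C D F" using is_cokernelE[OF ce] cod d by (metis HomD)
  note ed = Comp_in_Hom[OF d e]
  obtain k where kerk: "is_kernel C (e \<cdot>\<^bsub>C\<^esub> d) k"
    using kernel_exists HomD[OF ed] by blast
  then obtain K where k: "k \<in> Hom C K B"
    using ed by (metis is_kernelE HomD)
  obtain j where kerj: "is_kernel C e j"
    using kernel_exists HomD[OF e] by blast
  then obtain J where j: "j \<in> Hom C J D"
    using e by (metis is_kernelE HomD)
  have jI: "j \<in> Infl"
    using kernel_of_deflation[OF eD kerj] .
  obtain d' where pb: "is_pullback C d j d' k"
    using kernel_Comp_pullback[OF d e kerj kerk] by blast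
  then have d': "d' \<in> Hom C K J" and sq: "d \<cdot>\<^bsub>C\<^esub> k = j \<cdot>\<^bsub>C\<^esub> d'"
    using j k by (metis is_pullbackE HomD)+
  obtain i where keri: "is_kernel C d' i"
    using kernel_exists HomD[OF d'] by blast
  then obtain A where i: "i \<in> Hom C A K"
    using d' by (metis is_kernelE HomD)
  \<comment> \<open>By the pullback square, \<open>k i\<close> is a kernel of the deflation
    \<open>d\<close>.\<close>
  have kiI: "k \<cdot>\<^bsub>C\<^esub> i \<in> Infl"
    using kernel_of_deflation[OF dD pullback_kernel[OF pb keri]] .
  have coker: "is_cokernel C i d'"
    using cokernel_pullback[OF _ pb] cd cokernel_of_kernel[OF _ keri] by blast
  have BO: "B \<in> Ob C" and DO: "D \<in> Ob C" and JO: "J \<in> Ob C"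
    using Hom_Ob[OF d] Hom_Ob[OF j] by blast+
  obtain P i1 i2 p1 p2 where bp: "is_biproduct C B J P i1 i2 p1 p2"
    using is_biproduct_exists[OF BO JO] by blast
  obtain Q j1 j2 q1 q2 where bq: "is_biproduct C B D Q j1 j2 q1 q2"
    using is_biproduct_exists[OF BO DO] by blast
  have i1: "i1 \<in> Hom C B P" "p1 \<cdot>\<^bsub>C\<^esub> i1 = Ident C B" "p2 \<cdot>\<^bsub>C\<^esub> i1 = Zero C B J"
    and i2: "i2 \<in> Hom C J P" "p1 \<cdot>\<^bsub>C\<^esub> i2 = Zero C J B" "p2 \<cdot>\<^bsub>C\<^esub> i2 = Ident C J"
    and p1: "p1 \<in> Hom C P B" and p2: "p2 \<in> Hom C P J"
    using bp by (auto simp: is_biproduct_def)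
  have j1: "j1 \<in> Hom C B Q" "q1 \<cdot>\<^bsub>C\<^esub> j1 = Ident C B" "q2 \<cdot>\<^bsub>C\<^esub> j1 = Zero C B D"
    and j2: "j2 \<in> Hom C D Q" "q1 \<cdot>\<^bsub>C\<^esub> j2 = Zero C D B" "q2 \<cdot>\<^bsub>C\<^esub> j2 = Ident C D"
    and q1: "q1 \<in> Hom C Q B" and q2: "q2 \<in> Hom C Q D"
    using bq by (auto simp: is_biproduct_def)
  \<comment> \<open>\<open>s\<close> is \<open>(k, d')\<close>, a pushout of the inflation
    \<open>k i\<close> along \<open>i\<close>.\<close>
  obtain s where s: "s \<in> Hom C K P" and s1: "p1 \<cdot>\<^bsub>C\<^esub> s = k" and s2: "p2 \<cdot>\<^bsub>C\<^esub> s = d'"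
    using biproduct_pair[OF bp k d'] by blast
  have sI: "s \<in> Infl"
    using R2_inflation[OF kiI cokernel_pushout_biproduct[OF coker i d' k bp s s1 s2]] .
  note jp = Comp_in_Hom[OF p2 j]
  \<comment> \<open>\<open>t\<close> is \<open>1 \<oplus> j\<close>, given here by its components.
    The pushout lemma takes its restrictions to the two summands, which are computed next.\<close>
  obtain t where t: "t \<in> Hom C P Q" and t1: "q1 \<cdot>\<^bsub>C\<^esub> t = p1" and t2: "q2 \<cdot>\<^bsub>C\<^esub> t = j \<cdot>\<^bsub>C\<^esub> p2"
    using biproduct_pair[OF bq p1 jp] by blast
  have "t \<cdot>\<^bsub>C\<^esub> i1 = j1"
    using biproduct_jointly_monic[OF bq Comp_in_Hom[OF i1(1) t] j1(1)] t1 t2 i1 j1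
      Comp_assoc[OF i1(1) t q1] Comp_assoc[OF i1(1) t q2] Comp_assoc[OF i1(1) p2 j]
      Comp_Zero[OF j BO] by simp
  moreover have "t \<cdot>\<^bsub>C\<^esub> i2 = j2 \<cdot>\<^bsub>C\<^esub> j"
    using biproduct_jointly_monic[OF bq Comp_in_Hom[OF i2(1) t] Comp_in_Hom[OF j j2(1)]]
      t1 t2 i2 j2 Comp_assoc[OF i2(1) t q1] Comp_assoc[OF i2(1) t q2] Comp_assoc[OF i2(1) p2 j]
      Comp_assoc[OF j j2(1) q1] Comp_assoc[OF j j2(1) q2]
      Comp_Ident[OF j] Ident_Comp[OF j] Zero_Comp[OF j BO] by simp
  ultimately have tI: "t \<in> Infl"
    using R2_inflation[OF jI biproduct_pushout[OF bp bq j t]] by blast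
  have tsI: "t \<cdot>\<^bsub>C\<^esub> s \<in> Infl"
    using R1[OF sI tI] HomD[OF s] HomD[OF t] by simp
  \<comment> \<open>\<open>r\<close> is the graph \<open>(1, d)\<close> of \<open>d\<close>.\<close>
  obtain r where r: "r \<in> Hom C B Q" and r1: "q1 \<cdot>\<^bsub>C\<^esub> r = Ident C B" and r2: "q2 \<cdot>\<^bsub>C\<^esub> r = d"
    using biproduct_pair[OF bq Ident_in_Hom[OF BO] d] by blast
  \<comment> \<open>The first components are both \<open>k\<close>; the second ones are
    \<open>j d'\<close> and \<open>d k\<close>, which agree by the pullback square.\<close>
  have "t \<cdot>\<^bsub>C\<^esub> s = r \<cdot>\<^bsub>C\<^esub> k"
    using biproduct_jointly_monic[OF bq Comp_in_Hom[OF s t] Comp_in_Hom[OF k r]] t1 t2 s1 s2 r1 r2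
      Comp_assoc[OF s t q1] Comp_assoc[OF s t q2] Comp_assoc[OF k r q1] Comp_assoc[OF k r q2]
      Comp_assoc[OF s p2 j] Ident_Comp[OF k] sq by simp
  then have "k \<in> Infl"
    using inflation_cancel[OF k r] tsI by simp
  then show ?thesis
    using cokernel_Comp[OF cd ce d e kerk] by (auto simp: deflations_def)
qed

lemma deflations_left_exact: "left_exact_structure C deflations"
proof
  fix d f assume d: "d \<in> deflations" and f: "f \<in> Arr C" and cod: "Cod C f = Cod C d"
  have "d \<in> Arr C"
    using d by (auto simp: deflations_def is_cokernel_def)
  \<comment> \<open>Existence of this pullback comes from the pre-abelian structure; that the
    pulled-back morphism is again a deflation is the separate axiom settled by
    \<open>pullback_deflation\<close>.\<close>
  then show "\<exists>d' f'. is_pullback C d f d' f'"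
    using pullback_exists[OF Arr_in_Hom Arr_in_Hom[OF f, unfolded cod]] by blast
qed (use Ident_zero_deflation Comp_deflation pullback_deflation in \<open>auto simp: deflations_def\<close>)

end

theorem proposition4p3:
  fixes C :: "('o, 'm) additive_data" and Infl :: "'m set"
  assumes "left_quasi_abelian_category C"
    and "strongly_right_exact_structure C Infl"
  shows "exact_structure C Infl"
proof -
  interpret left_quasi_abelian_category C by fact
  interpret strongly_right_exact_structure C Infl by fact
  interpret left_quasi_abelian_strongly_right_exact C Infl ..
  show ?thesis
    unfolding exact_structure_def
    \<comment> \<open>The required left exact structure is given by
      \<open>deflations\<close>.\<close>
    using right_exact_structure_axioms deflations_left_exact left_conflations_deflations by blast
qed

end
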